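(* Let $\alpha\ge1$, let $m_0:[0,\infty)\to[0,\infty)$ be bounded, Lipschitz continuous and non-decreasing with $m_0(0)=0$, let $h_t,h_\rho>0$ satisfy (CFL), let $m$ be the viscosity solution of the mass problem with datum $m_0$, and let $M_j^n$ be constructed by scheme (M). Then for every $T>0$ there is a constant $C$, independent of $h_\rho$ (depending on $T$, $\alpha$, $m_0$), such that $$\sup_{j\ge0,\ 0\le n\le T/h_t}\big|m(t_n,\rho_j)-M_j^n\big|\le C\,h_\rho^{1/3},\qquad t_n=nh_t,\ \rho_j=jh_\rho.$$
   Context: (CFL): $\frac{h_t}{h_\rho}\le\frac{1}{2\alpha\|(m_0)_\rho\|_\infty^{\alpha-1}\|m_0\|_\infty}$. Scheme (M): with $H(s)=\big(\min\{s_+,\|(m_0)_\rho\|_\infty\}\big)^\alpha$, $M_j^0=m_0(\rho_j)$ ($j\ge0$), $M_0^n=0$ ($n>0$), $M_j^{n+1}=M_j^n\big/\big(1+h_tH\big(\frac{M_j^n-M_{j-1}^n}{h_\rho}\big)\big)$ for $j\ge1$, $n\ge0$. The mass problem is $m_t+(m_\rho)_+^\alpha m=0$ ($t,\rho>0$), $m(t,0)=0$, $m(0,\cdot)=m_0$, in the Crandall–Lions viscosity sense (Fréchet super/subdifferentials; subsolution: $p_1+(p_2)_+^\alpha m\le0$ on $D^+m$ with $m(0,\cdot)\le m_0$, $m(t,0)\le0$; supersolution: reversed on $D^-m$; solution: both); the viscosity solution is Lipschitz with constant $\|(m_0)_\rho\|_\infty$. *)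

theory Defs
  imports "HOL-Analysis.Analysis"
begin

definition sup_norm :: "(real \<Rightarrow> real) \<Rightarrow> real" where
  "sup_norm m0 = (SUP r\<in>{0..}. \<bar>m0 r\<bar>)"

text \<open>Sup norm of the derivative of the Lipschitz function m0, i.e. its best
  Lipschitz constant on [0,inf).\<close>
definition lip_const :: "(real \<Rightarrow> real) \<Rightarrow> real" where
  "lip_const m0 = (SUP xy\<in>{(x,y). 0 \<le> x \<and> 0 \<le> y \<and> x \<noteq> y}.
                     \<bar>m0 (fst xy) - m0 (snd xy)\<bar> / \<bar>fst xy - snd xy\<bar>)"

text \<open>CFL condition, written in multiplied-out form (1/0 = infinity convention).\<close>
definition CFL :: "real \<Rightarrow> (real \<Rightarrow> real) \<Rightarrow> real \<Rightarrow> real \<Rightarrow> bool" where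
  "CFL \<alpha> m0 ht hr \<longleftrightarrow>
     ht * (2 * \<alpha> * lip_const m0 powr (\<alpha> - 1) * sup_norm m0) \<le> hr"

definition Hfun :: "real \<Rightarrow> (real \<Rightarrow> real) \<Rightarrow> real \<Rightarrow> real" where
  "Hfun \<alpha> m0 s = (min (max s 0) (lip_const m0)) powr \<alpha>"

fun schemeM :: "real \<Rightarrow> (real \<Rightarrow> real) \<Rightarrow> real \<Rightarrow> real \<Rightarrow> nat \<Rightarrow> nat \<Rightarrow> real" where
  "schemeM \<alpha> m0 ht hr 0 j = m0 (real j * hr)"
| "schemeM \<alpha> m0 ht hr (Suc n) 0 = 0"
| "schemeM \<alpha> m0 ht hr (Suc n) (Suc j) =
     schemeM \<alpha> m0 ht hr n (Suc j) /
       (1 + ht * Hfun \<alpha> m0 ((schemeM \<alpha> m0 ht hr n (Suc j) - schemeM \<alpha> m0 ht hr n j) / hr))"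

definition frechet_superdiff :: "(real \<times> real \<Rightarrow> real) \<Rightarrow> real \<times> real \<Rightarrow> (real \<times> real) set" where
  "frechet_superdiff u x = {p. \<forall>e>0. eventually
      (\<lambda>y. u y - u x - p \<bullet> (y - x) \<le> e * norm (y - x)) (at x)}"

definition frechet_subdiff :: "(real \<times> real \<Rightarrow> real) \<Rightarrow> real \<times> real \<Rightarrow> (real \<times> real) set" where
  "frechet_subdiff u x = {p. \<forall>e>0. eventually
      (\<lambda>y. u y - u x - p \<bullet> (y - x) \<ge> - e * norm (y - x)) (at x)}"

text \<open>Viscosity sub/supersolutions of m_t + (m_rho)_+^alpha m = 0, m(t,0)=0, m(0,.)=m0.
  m t rho is the value at time t, mass coordinate rho.\<close>
definition visc_sub :: "real \<Rightarrow> (real \<Rightarrow> real) \<Rightarrow> (real \<Rightarrow> real \<Rightarrow> real) \<Rightarrow> bool" where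
  "visc_sub \<alpha> m0 m \<longleftrightarrow>
     (\<forall>t>0. \<forall>r>0. \<forall>p \<in> frechet_superdiff (\<lambda>(s,q). m s q) (t, r).
         fst p + (max (snd p) 0) powr \<alpha> * m t r \<le> 0)
   \<and> (\<forall>r\<ge>0. m 0 r \<le> m0 r) \<and> (\<forall>t>0. m t 0 \<le> 0)"

definition visc_super :: "real \<Rightarrow> (real \<Rightarrow> real) \<Rightarrow> (real \<Rightarrow> real \<Rightarrow> real) \<Rightarrow> bool" where
  "visc_super \<alpha> m0 m \<longleftrightarrow>
     (\<forall>t>0. \<forall>r>0. \<forall>p \<in> frechet_subdiff (\<lambda>(s,q). m s q) (t, r).
         fst p + (max (snd p) 0) powr \<alpha> * m t r \<ge> 0)
   \<and> (\<forall>r\<ge>0. m 0 r \<ge> m0 r) \<and> (\<forall>t>0. m t 0 \<ge> 0)"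

definition visc_solution :: "real \<Rightarrow> (real \<Rightarrow> real) \<Rightarrow> (real \<Rightarrow> real \<Rightarrow> real) \<Rightarrow> bool" where
  "visc_solution \<alpha> m0 m \<longleftrightarrow>
     continuous_on ({0..} \<times> {0..}) (\<lambda>(t,r). m t r) \<and> visc_sub \<alpha> m0 m \<and> visc_super \<alpha> m0 m"

end

theory Submission
  imports Defs
begin

text \<open>
  Sliding a smoothed cone of slope \<open>L + 1\<close> under the solution shows \<open>m0 - K t \<le> m\<close>, and local test
  functions show \<open>0 \<le> m \<le> m0\<close>. Under the CFL
  condition the scheme is monotone and keeps slopes in \<open>[0, L]\<close>. Instead of doubling all variables,
  one compares, by induction on \<open>n\<close>, the grid values \<open>M n j\<close> with the sup- and inf-convolutions of \<open>m\<close>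
  with parabolas of width \<open>\<epsilon>\<close> centred at the grid points: the consistency error per unit time is
  \<open>O(hr / \<epsilon>)\<close> and the regularisation error is \<open>O(\<epsilon>)\<close>. The choice \<open>\<epsilon> = sqrt hr\<close> gives the rate
  \<open>hr powr (1/2)\<close> for \<open>hr \<le> 1\<close>; for \<open>hr \<ge> 1\<close> the bound is trivial.
\<close>

section \<open>Elementary estimates\<close>

text \<open>Mean value theorem: the derivative \<open>\<alpha> * z powr (\<alpha> - 1)\<close> is
  nondecreasing since \<open>1 \<le> \<alpha>\<close>, hence at most its value at \<open>R\<close>.
  Differentiability is used only inside the interval, so \<open>x = 0\<close> is allowed.\<close>

lemma powr_diff_le:
  fixes \<alpha> x y R :: real
  assumes "1 \<le> \<alpha>" "0 \<le> x" "x \<le> y" "y \<le> R"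
  shows "y powr \<alpha> - x powr \<alpha> \<le> \<alpha> * R powr (\<alpha> - 1) * (y - x)"
proof (cases "x = y")
  case False
  then have xy: "x < y" using assms by simp
  have "continuous_on {x..y} (\<lambda>z. z powr \<alpha>)"
    using assms by (intro continuous_on_powr') (auto intro: continuous_intros)
  moreover have "(\<lambda>z. z powr \<alpha>) differentiable (at z)" if "x < z" "z < y" for z
    using that assms has_real_derivative_powr[of z \<alpha>] unfolding real_differentiable_def by force
  ultimately obtain l z where z: "x < z" "z < y" "((\<lambda>z. z powr \<alpha>) has_real_derivative l) (at z)"
    "y powr \<alpha> - x powr \<alpha> = (y - x) * l"
    using MVT[OF xy, of "\<lambda>z. z powr \<alpha>"] by blast
  have "((\<lambda>z. z powr \<alpha>) has_real_derivative \<alpha> * z powr (\<alpha> - 1)) (at z)"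
    using z(1) assms by (intro has_real_derivative_powr) auto
  then have "l = \<alpha> * z powr (\<alpha> - 1)" using z(3) DERIV_unique by blast
  also have "\<dots> \<le> \<alpha> * R powr (\<alpha> - 1)"
    using assms z(1,2) by (intro mult_left_mono powr_mono2) auto
  finally have "(y - x) * l \<le> (y - x) * (\<alpha> * R powr (\<alpha> - 1))"
    using xy by (intro mult_left_mono) auto
  then show ?thesis using z(4) by (simp add: mult.commute)
qed simp

text \<open>The difference of the two sides is a perfect square over \<open>2 * \<epsilon>\<close>.
  It absorbs a Lipschitz term into a parabola of width \<open>\<epsilon>\<close> at a cost of order
  \<open>\<epsilon>\<close>.\<close>

lemma young_le:
  fixes a x \<epsilon> :: real
  assumes "0 < \<epsilon>"
  shows "a * x \<le> x\<^sup>2 / (2 * \<epsilon>) + a\<^sup>2 * \<epsilon> / 2"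
proof -
  have "x\<^sup>2 / (2 * \<epsilon>) + a\<^sup>2 * \<epsilon> / 2 - a * x = (x - a * \<epsilon>)\<^sup>2 / (2 * \<epsilon>)"
    using assms by (simp add: field_simps power2_eq_square)
  moreover have "0 \<le> (x - a * \<epsilon>)\<^sup>2 / (2 * \<epsilon>)" using assms by simp
  ultimately show ?thesis by linarith
qed

text \<open>Makes extremal points on the far sides of a rectangle harmless: the penalty there
  outweighs every value up to \<open>b\<close>. The summand \<open>1\<close> yields
  \<open>x \<le> x * x\<close>.\<close>

lemma le_parabola:
  fixes b x \<epsilon> :: real
  assumes "0 < \<epsilon>" "0 \<le> b" "2 * \<epsilon> * b + 1 \<le> x"
  shows "b \<le> x\<^sup>2 / (2 * \<epsilon>)"
proof -
  have "0 \<le> 2 * \<epsilon> * b" using assms by simp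
  then have "1 \<le> x" "2 * \<epsilon> * b \<le> x" using assms(3) by linarith+
  moreover from this have "x \<le> x * x" using mult_left_mono[of 1 x x] by simp
  ultimately have "2 * \<epsilon> * b \<le> x * x" by linarith
  then show ?thesis using assms(1) by (simp add: pos_le_divide_eq power2_eq_square mult_ac)
qed

section \<open>Derivatives of barriers and penalties\<close>

lemma exp_DERIV: "((\<lambda>t. c * exp (N * (t - s))) has_real_derivative c * N * exp (N * (t - s))) (at t)"
  for c N s t :: real
  by (auto intro!: derivative_eq_intros)

lemma square_DERIV: "((\<lambda>r. k * (r - s)\<^sup>2) has_real_derivative 2 * k * (r - s)) (at r)"
  for k r s :: real
  by (auto intro!: derivative_eq_intros)

text \<open>Rounding the tip by \<open>d\<close> makes the cone differentiable everywhere, while its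
  slope stays at most \<open>\<bar>l\<bar>\<close> in modulus.\<close>

lemma smooth_cone_DERIV:
  fixes l d r s :: real
  assumes "0 < d"
  shows "((\<lambda>r. l * sqrt ((r - s)\<^sup>2 + d\<^sup>2)) has_real_derivative l * ((r - s) / sqrt ((r - s)\<^sup>2 + d\<^sup>2))) (at r)"
proof -
  have "0 < (r - s)\<^sup>2 + d\<^sup>2" "sqrt (d\<^sup>2 + (r - s)\<^sup>2) \<noteq> 0"
    using assms by (simp_all add: add_nonneg_pos add_pos_nonneg less_imp_neq[symmetric])
  then show ?thesis by (auto intro!: derivative_eq_intros simp: field_simps)
qed

lemma parabola_DERIV: "((\<lambda>t. (t - s)\<^sup>2 / (2 * \<epsilon>)) has_real_derivative (t - s) / \<epsilon>) (at t)"
  for s \<epsilon> t :: real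
proof -
  have "((\<lambda>t. (t - s)\<^sup>2) has_real_derivative 2 * (t - s)) (at t)"
    by (auto intro!: derivative_eq_intros)
  moreover have "2 * (t - s) / (2 * \<epsilon>) = (t - s) / \<epsilon>" by (rule mult_divide_mult_cancel_left) simp
  ultimately show ?thesis using DERIV_cdivide[of "\<lambda>t. (t - s)\<^sup>2" "2 * (t - s)" t UNIV "2 * \<epsilon>"] by (simp only:)
qed

section \<open>Test functions on rectangles\<close>

text \<open>Increments of \<open>u\<close> from the maximum point are at most those of the
  differentiable function \<open>f s + g q\<close>; each variable receives half of \<open>e\<close>.
  The point must be interior because the superdifferential looks at a full neighbourhood in the
  plane.\<close>

lemma superdiff_of_local_max:
  fixes u :: "real \<Rightarrow> real \<Rightarrow> real"
  assumes f: "(f has_real_derivative a) (at t)" and g: "(g has_real_derivative b) (at r)"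
    and t: "0 < t" "t < T" and r: "0 < r" "r < R"
    and mx: "\<And>s q. s \<in> {0..T} \<Longrightarrow> q \<in> {0..R} \<Longrightarrow> u s q - f s - g q \<le> u t r - f t - g r"
  shows "(a, b) \<in> frechet_superdiff (\<lambda>(s, q). u s q) (t, r)"
  unfolding frechet_superdiff_def
proof (intro CollectI allI impI)
  fix e :: real
  assume "0 < e"
  then have e2: "0 < e / 2" by simp
  obtain d1 where d1: "0 < d1" "\<And>s. \<bar>s - t\<bar> < d1 \<Longrightarrow> \<bar>f s - f t - a * (s - t)\<bar> \<le> e / 2 * \<bar>s - t\<bar>"
    using f e2 unfolding has_field_derivative_def has_derivative_at_alt real_norm_def by blast
  obtain d2 where d2: "0 < d2" "\<And>q. \<bar>q - r\<bar> < d2 \<Longrightarrow> \<bar>g q - g r - b * (q - r)\<bar> \<le> e / 2 * \<bar>q - r\<bar>"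
    using g e2 unfolding has_field_derivative_def has_derivative_at_alt real_norm_def by blast
  \<comment> \<open>The ball of radius \<open>d\<close> stays inside the rectangle and within the
    range of both first-order expansions.\<close>
  define d where "d = Min {d1, d2, t, T - t, r, R - r}"
  have d: "0 < d" "d \<le> d1" "d \<le> d2" "d \<le> t" "d \<le> T - t" "d \<le> r" "d \<le> R - r"
    using d1(1) d2(1) t r by (auto simp: d_def)
  show "\<forall>\<^sub>F y in at (t, r). (case y of (s, q) \<Rightarrow> u s q) - (case (t, r) of (s, q) \<Rightarrow> u s q)
      - (a, b) \<bullet> (y - (t, r)) \<le> e * norm (y - (t, r))"
    unfolding eventually_at
  proof (intro exI[of _ d] conjI ballI impI d(1))
    fix y assume y: "y \<noteq> (t, r) \<and> dist y (t, r) < d"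
    obtain s q where sq: "y = (s, q)" by fastforce
    let ?N = "norm (y - (t, r))"
    have n1: "\<bar>s - t\<bar> \<le> ?N" and n2: "\<bar>q - r\<bar> \<le> ?N"
      using norm_fst_le[of "s - t" "q - r"] norm_snd_le[of "q - r" "s - t"] by (auto simp: sq)
    have N: "?N < d" using y by (simp add: dist_norm)
    have "u s q - f s - g q \<le> u t r - f t - g r"
      using n1 n2 N d by (intro mx) auto
    moreover have "\<bar>f s - f t - a * (s - t)\<bar> \<le> e / 2 * ?N"
      using order_trans[OF d1(2) mult_left_mono[OF n1]] n1 N d e2 by linarith
    moreover have "\<bar>g q - g r - b * (q - r)\<bar> \<le> e / 2 * ?N"
      using order_trans[OF d2(2) mult_left_mono[OF n2]] n2 N d e2 by linarith
    ultimately have "u s q - u t r - (a * (s - t) + b * (q - r)) \<le> e * ?N"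
      unfolding abs_le_iff by linarith
    then show "(case y of (s, q) \<Rightarrow> u s q) - (case (t, r) of (s, q) \<Rightarrow> u s q)
      - (a, b) \<bullet> (y - (t, r)) \<le> e * ?N"
      by (simp add: sq)
  qed
qed

text \<open>Compactness gives a maximum; in the interior the gradient of the test function is a
  supergradient. The four sides, the final time \<open>T\<close> among them, are left to each
  application.\<close>

lemma rectangle_max:
  fixes u :: "real \<Rightarrow> real \<Rightarrow> real"
  assumes cont: "continuous_on ({0..} \<times> {0..}) (\<lambda>(t, r). u t r)"
    and f: "\<And>t. (f has_real_derivative f' t) (at t)" and g: "\<And>r. (g has_real_derivative g' r) (at r)"
    and "0 \<le> T" "0 \<le> R"
  shows "\<exists>t r. 0 \<le> t \<and> t \<le> T \<and> 0 \<le> r \<and> r \<le> R \<and>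
    (\<forall>s\<in>{0..T}. \<forall>q\<in>{0..R}. u s q - f s - g q \<le> u t r - f t - g r) \<and>
    (t = 0 \<or> t = T \<or> r = 0 \<or> r = R \<or> (f' t, g' r) \<in> frechet_superdiff (\<lambda>(s, q). u s q) (t, r))"
proof -
  let ?Q = "{0..T} \<times> {0..R}"
  have cf: "continuous_on UNIV f" and cg: "continuous_on UNIV g"
    using DERIV_isCont[OF f] DERIV_isCont[OF g] by (auto intro: continuous_at_imp_continuous_on)
  define F where "F = (\<lambda>x. (case x of (t, r) \<Rightarrow> u t r) - f (fst x) - g (snd x))"
  have "continuous_on ?Q F"
    unfolding F_def by (intro continuous_intros continuous_on_subset[OF cont]
        continuous_on_compose2[OF cf] continuous_on_compose2[OF cg]) auto
  moreover have "compact ?Q" "?Q \<noteq> {}" using assms(4,5) by (auto intro: compact_Times)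
  ultimately obtain x where "x \<in> ?Q" "\<forall>y\<in>?Q. F y \<le> F x"
    using continuous_attains_sup[of ?Q F] by blast
  moreover obtain t r where tr: "x = (t, r)" by fastforce
  ultimately have b: "0 \<le> t" "t \<le> T" "0 \<le> r" "r \<le> R"
    and F_le: "\<And>s q. s \<in> {0..T} \<Longrightarrow> q \<in> {0..R} \<Longrightarrow> F (s, q) \<le> F (t, r)" by auto
  have mx: "u s q - f s - g q \<le> u t r - f t - g r" if "s \<in> {0..T}" "q \<in> {0..R}" for s q
    using F_le[OF that] by (simp add: F_def)
  have "(f' t, g' r) \<in> frechet_superdiff (\<lambda>(s, q). u s q) (t, r)"
    if "t \<noteq> 0" "t \<noteq> T" "r \<noteq> 0" "r \<noteq> R"
    using that b by (intro superdiff_of_local_max[where T = T and R = R, OF f g] mx) auto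
  then have "t = 0 \<or> t = T \<or> r = 0 \<or> r = R \<or> (f' t, g' r) \<in> frechet_superdiff (\<lambda>(s, q). u s q) (t, r)"
    by argo
  with b mx show ?thesis by blast
qed

text \<open>Negation exchanges the two notions, so minima reduce to maxima.\<close>

lemma subdiff_iff_superdiff:
  "p \<in> frechet_subdiff u x \<longleftrightarrow> - p \<in> frechet_superdiff (\<lambda>y. - u y) x"
proof -
  have "(u y - u x - p \<bullet> (y - x) \<ge> - e * norm (y - x))
      \<longleftrightarrow> (- u y - - u x - (- p) \<bullet> (y - x) \<le> e * norm (y - x))" for e y
    by (auto simp: inner_minus_left)
  then show ?thesis unfolding frechet_subdiff_def frechet_superdiff_def by simp
qed

text \<open>This is \<open>rectangle_max\<close> for \<open>- u\<close>. The penalties are added, so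
  \<open>- f - g\<close> touches \<open>u\<close> from below, whence the signs of the
  subgradient.\<close>

lemma rectangle_min:
  fixes u :: "real \<Rightarrow> real \<Rightarrow> real"
  assumes cont: "continuous_on ({0..} \<times> {0..}) (\<lambda>(t, r). u t r)"
    and f: "\<And>t. (f has_real_derivative f' t) (at t)" and g: "\<And>r. (g has_real_derivative g' r) (at r)"
    and "0 \<le> T" "0 \<le> R"
  shows "\<exists>t r. 0 \<le> t \<and> t \<le> T \<and> 0 \<le> r \<and> r \<le> R \<and>
    (\<forall>s\<in>{0..T}. \<forall>q\<in>{0..R}. u t r + f t + g r \<le> u s q + f s + g q) \<and>
    (t = 0 \<or> t = T \<or> r = 0 \<or> r = R \<or> (- f' t, - g' r) \<in> frechet_subdiff (\<lambda>(s, q). u s q) (t, r))"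
proof -
  have "continuous_on ({0..} \<times> {0..}) (\<lambda>(t, r). - u t r)"
    using continuous_on_minus[OF cont] by (simp add: case_prod_unfold)
  note rectangle_max[of "\<lambda>t r. - u t r", OF this f g assms(4,5)]
  moreover have "- u s q - f s - g q \<le> - u t r - f t - g r \<longleftrightarrow> u t r + f t + g r \<le> u s q + f s + g q"
    for s q t r by linarith
  ultimately show ?thesis by (simp add: subdiff_iff_superdiff case_prod_unfold)
qed

section \<open>A priori bounds for the viscosity solution\<close>

locale mass_problem =
  fixes \<alpha> :: real and m0 :: "real \<Rightarrow> real" and m :: "real \<Rightarrow> real \<Rightarrow> real"
  assumes alpha: "1 \<le> \<alpha>"
    and m0_nonneg: "\<And>r. 0 \<le> r \<Longrightarrow> 0 \<le> m0 r"
    and m0_bounded: "bounded (m0 ` {0..})"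
    and m0_lipschitz: "\<exists>K. K-lipschitz_on {0..} m0"
    and m0_mono: "mono_on {0..} m0"
    and m0_zero: "m0 0 = 0"
    and solution: "visc_solution \<alpha> m0 m"
begin

section \<open>Bounds for the datum and the equation in test-function form\<close>

abbreviation "L \<equiv> lip_const m0"
abbreviation "B \<equiv> sup_norm m0"

text \<open>A real \<open>SUP\<close> is an upper bound only for a set bounded above; boundedness of
  the datum supplies this here, its Lipschitz continuity in \<open>m0_lip\<close>.\<close>

lemma m0_le: "0 \<le> r \<Longrightarrow> m0 r \<le> B"
proof -
  assume r: "0 \<le> r"
  obtain c where "\<And>x. 0 \<le> x \<Longrightarrow> \<bar>m0 x\<bar> \<le> c"
    using m0_bounded unfolding bounded_iff by auto
  then have "bdd_above ((\<lambda>r. \<bar>m0 r\<bar>) ` {0..})" by (auto intro: bdd_aboveI[where M = c])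
  then have "\<bar>m0 r\<bar> \<le> B" unfolding sup_norm_def using r by (intro cSUP_upper) auto
  then show ?thesis by simp
qed

lemma m0_lip: "0 \<le> x \<Longrightarrow> 0 \<le> y \<Longrightarrow> \<bar>m0 x - m0 y\<bar> \<le> L * \<bar>x - y\<bar>"
proof (cases "x = y")
  case False
  assume xy: "0 \<le> x" "0 \<le> y"
  let ?S = "{(x :: real, y). 0 \<le> x \<and> 0 \<le> y \<and> x \<noteq> y}"
  let ?f = "\<lambda>xy. \<bar>m0 (fst xy) - m0 (snd xy)\<bar> / \<bar>fst xy - snd xy\<bar>"
  obtain K where K: "K-lipschitz_on {0..} m0" using m0_lipschitz by blast
  have "?f z \<le> K" if "z \<in> ?S" for z
    using that lipschitz_onD[OF K, of "fst z" "snd z"]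
    by (auto simp: divide_le_eq dist_real_def)
  then have "bdd_above (?f ` ?S)" by (auto intro: bdd_aboveI[where M = K])
  then have "?f (x, y) \<le> L" unfolding lip_const_def using xy False by (intro cSUP_upper) auto
  then show ?thesis using False by (simp add: divide_le_eq)
qed simp

lemma m0_diff_le: "0 \<le> x \<Longrightarrow> 0 \<le> y \<Longrightarrow> m0 x \<le> m0 y + L * \<bar>x - y\<bar>"
  using m0_lip[of x y] by linarith

lemma B_nonneg: "0 \<le> B" using m0_le[of 0] m0_zero by simp
lemma L_nonneg: "0 \<le> L" using m0_lip[of 1 0] by simp

lemma m_cont: "continuous_on ({0..} \<times> {0..}) (\<lambda>(t, r). m t r)"
  using solution by (simp add: visc_solution_def)

lemma m_initial: "0 \<le> r \<Longrightarrow> m 0 r = m0 r"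
  using solution unfolding visc_solution_def visc_sub_def visc_super_def by (meson antisym)

lemma m_boundary: "0 \<le> t \<Longrightarrow> m t 0 = 0"
proof (cases "t = 0")
  case False
  assume "0 \<le> t"
  with False have "0 < t" by simp
  then show ?thesis
    using solution unfolding visc_solution_def visc_sub_def visc_super_def by (meson antisym)
qed (simp add: m_initial m0_zero)

lemma subsolution:
  "0 < t \<Longrightarrow> 0 < r \<Longrightarrow> (a, b) \<in> frechet_superdiff (\<lambda>(s, q). m s q) (t, r) \<Longrightarrow>
    a + (max b 0) powr \<alpha> * m t r \<le> 0"
  using solution unfolding visc_solution_def visc_sub_def by (metis fst_conv snd_conv)

lemma supersolution:
  "0 < t \<Longrightarrow> 0 < r \<Longrightarrow> (a, b) \<in> frechet_subdiff (\<lambda>(s, q). m s q) (t, r) \<Longrightarrow>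
    0 \<le> a + (max b 0) powr \<alpha> * m t r"
  using solution unfolding visc_solution_def visc_super_def by (metis fst_conv snd_conv)

text \<open>Together with \<open>m_min\<close>, the only access to the interior equation used
  below.\<close>

lemma m_max:
  assumes "\<And>t. (f has_real_derivative f' t) (at t)" "\<And>r. (g has_real_derivative g' r) (at r)"
    and "0 \<le> T" "0 \<le> R"
  shows "\<exists>t r. 0 \<le> t \<and> t \<le> T \<and> 0 \<le> r \<and> r \<le> R \<and>
    (\<forall>s\<in>{0..T}. \<forall>q\<in>{0..R}. m s q - f s - g q \<le> m t r - f t - g r) \<and>
    (t = 0 \<or> t = T \<or> r = 0 \<or> r = R \<or> f' t + (max (g' r) 0) powr \<alpha> * m t r \<le> 0)"
proof -
  obtain t r where *: "0 \<le> t \<and> t \<le> T \<and> 0 \<le> r \<and> r \<le> R \<and>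
    (\<forall>s\<in>{0..T}. \<forall>q\<in>{0..R}. m s q - f s - g q \<le> m t r - f t - g r) \<and>
    (t = 0 \<or> t = T \<or> r = 0 \<or> r = R \<or> (f' t, g' r) \<in> frechet_superdiff (\<lambda>(s, q). m s q) (t, r))"
    using rectangle_max[OF m_cont assms] by blast
  moreover from * have "t = 0 \<or> r = 0 \<or> 0 < t \<and> 0 < r" by linarith
  ultimately show ?thesis using subsolution[of t r "f' t" "g' r"] by blast
qed

lemma m_min:
  assumes "\<And>t. (f has_real_derivative f' t) (at t)" "\<And>r. (g has_real_derivative g' r) (at r)"
    and "0 \<le> T" "0 \<le> R"
  shows "\<exists>t r. 0 \<le> t \<and> t \<le> T \<and> 0 \<le> r \<and> r \<le> R \<and>
    (\<forall>s\<in>{0..T}. \<forall>q\<in>{0..R}. m t r + f t + g r \<le> m s q + f s + g q) \<and>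
    (t = 0 \<or> t = T \<or> r = 0 \<or> r = R \<or> f' t \<le> (max (- g' r) 0) powr \<alpha> * m t r)"
proof -
  obtain t r where *: "0 \<le> t \<and> t \<le> T \<and> 0 \<le> r \<and> r \<le> R \<and>
    (\<forall>s\<in>{0..T}. \<forall>q\<in>{0..R}. m t r + f t + g r \<le> m s q + f s + g q) \<and>
    (t = 0 \<or> t = T \<or> r = 0 \<or> r = R \<or> (- f' t, - g' r) \<in> frechet_subdiff (\<lambda>(s, q). m s q) (t, r))"
    using rectangle_min[OF m_cont assms] by blast
  moreover from * have "t = 0 \<or> r = 0 \<or> 0 < t \<and> 0 < r" by linarith
  moreover have "f' t \<le> (max (- g' r) 0) powr \<alpha> * m t r"
    if "0 < t" "0 < r" "(- f' t, - g' r) \<in> frechet_subdiff (\<lambda>(s, q). m s q) (t, r)"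
    using supersolution[OF that] by linarith
  ultimately show ?thesis by blast
qed

lemma m_bounded_rectangle:
  "\<exists>W>0. \<forall>t\<in>{0..T}. \<forall>r\<in>{0..R}. \<bar>m t r\<bar> < W"
proof -
  have "compact ((\<lambda>(t, r). m t r) ` ({0..T} \<times> {0..R}))"
    by (intro compact_continuous_image continuous_on_subset[OF m_cont] compact_Times) auto
  then obtain W where "0 < W" "\<forall>x\<in>(\<lambda>(t, r). m t r) ` ({0..T} \<times> {0..R}). norm x < W"
    using compact_imp_bounded bounded_pos_less by blast
  then show ?thesis by (intro exI[of _ W]) auto
qed

text \<open>The steep exponential keeps the extremal point away from the final time of the rectangle while
  contributing only \<open>c\<close> at time \<open>t0\<close>; its derivative has a strict sign.\<close>

lemma m_nonneg:
  assumes t0: "0 \<le> t0" and r0: "0 \<le> r0"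
  shows "0 \<le> m t0 r0"
proof (rule ccontr)
  assume neg: "\<not> 0 \<le> m t0 r0"
  obtain W where W: "0 < W" "\<forall>t\<in>{0..t0 + 1}. \<forall>r\<in>{0..r0 + 1}. \<bar>m t r\<bar> < W"
    using m_bounded_rectangle by blast
  define c where "c = - m t0 r0 / 2"
  have c: "0 < c" "m t0 r0 + c < 0" using neg by (auto simp: c_def)
  \<comment> \<open>Now \<open>c * exp N\<close> is at least \<open>c * N = W\<close>, which exceeds
    \<open>\<bar>m\<bar>\<close> on the rectangle and so excludes the final time.\<close>
  define N where "N = W / c"
  have N: "0 < N" "c * N = W" using c W by (auto simp: N_def)
  obtain t r where tr: "0 \<le> t" "t \<le> t0 + 1" "0 \<le> r" "r \<le> r0 + 1"
    and mn: "\<forall>s\<in>{0..t0 + 1}. \<forall>q\<in>{0..r0 + 1}.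
      m t r + c * exp (N * (t - t0)) + W * (r - r0)\<^sup>2 \<le> m s q + c * exp (N * (s - t0)) + W * (q - r0)\<^sup>2"
    and alt: "t = 0 \<or> t = t0 + 1 \<or> r = 0 \<or> r = r0 + 1 \<or>
      c * N * exp (N * (t - t0)) \<le> (max (- (2 * W * (r - r0))) 0) powr \<alpha> * m t r"
    using m_min[OF exp_DERIV square_DERIV, of "t0 + 1" "r0 + 1" c N t0 W r0] t0 r0 by auto
  have val: "m t r + c * exp (N * (t - t0)) + W * (r - r0)\<^sup>2 \<le> m t0 r0 + c"
    using mn t0 r0 by force
  have Wtr: "\<bar>m t r\<bar> < W" using W(2) tr by simp
  have pos: "0 < c * exp (N * (t - t0))" "0 \<le> W * (r - r0)\<^sup>2" using c W by auto
  have neg': "m t r < 0" using val pos c by linarith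
  have "t \<noteq> 0" using neg' m_initial m0_nonneg tr by force
  moreover have "r \<noteq> 0" using neg' m_boundary tr by force
  moreover have "r \<noteq> r0 + 1"
  proof
    assume "r = r0 + 1"
    then have "W * (r - r0)\<^sup>2 = W" by simp
    then show False using val pos c Wtr by linarith
  qed
  moreover have "t \<noteq> t0 + 1"
  proof
    assume "t = t0 + 1"
    moreover have "N \<le> exp N" using exp_ge_add_one_self[of N] by linarith
    ultimately have "c * N \<le> c * exp (N * (t - t0))" using c by simp
    then show False using N val pos c Wtr by linarith
  qed
  ultimately have "c * N * exp (N * (t - t0)) \<le> (max (- (2 * W * (r - r0))) 0) powr \<alpha> * m t r"
    using alt by blast
  also have "\<dots> \<le> 0" using neg' by (intro mult_nonneg_nonpos) auto
  finally show False using c N W by (simp add: mult_le_0_iff)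
qed

text \<open>Since \<open>0 \<le> m\<close>, the Hamiltonian is nonnegative, so \<open>m\<close>
  cannot be touched from above at an interior point by a function whose time derivative is
  positive.\<close>

lemma m_le_m0:
  assumes t0: "0 \<le> t0" and r0: "0 \<le> r0"
  shows "m t0 r0 \<le> m0 r0"
proof (rule ccontr)
  assume gt: "\<not> m t0 r0 \<le> m0 r0"
  obtain W where W: "0 < W" "\<forall>t\<in>{0..t0 + 1}. \<forall>r\<in>{0..r0 + 1}. \<bar>m t r\<bar> < W"
    using m_bounded_rectangle by blast
  \<comment> \<open>A third of the excess: one \<open>c\<close> pays for the exponential at
    \<open>t0\<close>, one for the Lipschitz term at \<open>t = 0\<close>, and the last one gives
    the contradiction.\<close>
  define c where "c = (m t0 r0 - m0 r0) / 3"
  have c: "0 < c" "m t0 r0 - c = m0 r0 + 2 * c" using gt by (auto simp: c_def field_simps)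
  define N where "N = W / c"
  have N: "0 < N" "c * N = W" using c W by (auto simp: N_def)
  \<comment> \<open>\<open>W \<le> k\<close> excludes the side \<open>r = r0 + 1\<close>; the second
    summand keeps the Young cost \<open>L\<^sup>2 / (4 * k)\<close> at most
    \<open>c\<close>.\<close>
  define k where "k = W + L\<^sup>2 / (4 * c)"
  have k: "0 < k" "W \<le> k" "L\<^sup>2 / (4 * c) \<le> k" using W c by (auto simp: k_def add_pos_nonneg)
  have Lk: "L\<^sup>2 / (4 * k) \<le> c" using k c by (simp add: field_simps)
  obtain t r where tr: "0 \<le> t" "t \<le> t0 + 1" "0 \<le> r" "r \<le> r0 + 1"
    and mx: "\<forall>s\<in>{0..t0 + 1}. \<forall>q\<in>{0..r0 + 1}.
      m s q - c * exp (N * (s - t0)) - k * (q - r0)\<^sup>2 \<le> m t r - c * exp (N * (t - t0)) - k * (r - r0)\<^sup>2"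
    and alt: "t = 0 \<or> t = t0 + 1 \<or> r = 0 \<or> r = r0 + 1 \<or>
      c * N * exp (N * (t - t0)) + (max (2 * k * (r - r0)) 0) powr \<alpha> * m t r \<le> 0"
    using m_max[OF exp_DERIV square_DERIV, of "t0 + 1" "r0 + 1" c N t0 k r0] t0 r0 by auto
  have val: "m0 r0 + 2 * c \<le> m t r - c * exp (N * (t - t0)) - k * (r - r0)\<^sup>2"
    using mx[rule_format, of t0 r0] t0 r0 c by simp
  have Wtr: "\<bar>m t r\<bar> < W" using W(2) tr by simp
  have pos: "0 < c * exp (N * (t - t0))" "0 \<le> k * (r - r0)\<^sup>2" using c k by auto
  have m0r0: "0 \<le> m0 r0" using m0_nonneg r0 by simp
  have "t \<noteq> 0"
  proof
    assume "t = 0"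
    then have "m t r \<le> m0 r0 + L * \<bar>r - r0\<bar>" using m_initial m0_diff_le tr r0 by simp
    also have "L * \<bar>r - r0\<bar> \<le> k * (r - r0)\<^sup>2 + L\<^sup>2 / (4 * k)"
      using young_le[of "1 / (2 * k)" L "\<bar>r - r0\<bar>"] k by (simp add: mult.commute)
    finally show False using val pos Lk c by linarith
  qed
  moreover have "r \<noteq> 0"
  proof
    assume "r = 0"
    then have "m t r = 0" using m_boundary tr by simp
    then show False using val pos c m0r0 by linarith
  qed
  moreover have "r \<noteq> r0 + 1"
  proof
    assume "r = r0 + 1"
    then have "k * (r - r0)\<^sup>2 = k" by simp
    then show False using val pos c k Wtr m0r0 by linarith
  qed
  moreover have "t \<noteq> t0 + 1"
  proof
    assume "t = t0 + 1"
    moreover have "N \<le> exp N" using exp_ge_add_one_self[of N] by linarith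
    ultimately have "c * N \<le> c * exp (N * (t - t0))" using c by simp
    then show False using N val pos c Wtr m0r0 by linarith
  qed
  ultimately have "c * N * exp (N * (t - t0)) + (max (2 * k * (r - r0)) 0) powr \<alpha> * m t r \<le> 0"
    using alt by blast
  moreover have "0 \<le> (max (2 * k * (r - r0)) 0) powr \<alpha> * m t r" using m_nonneg tr by simp
  moreover have "0 < c * N * exp (N * (t - t0))" using N W by simp
  ultimately show False by linarith
qed

lemma m_le_B: "0 \<le> t \<Longrightarrow> 0 \<le> r \<Longrightarrow> m t r \<le> B"
  using m_le_m0 m0_le order_trans by blast

text \<open>For slopes up to \<open>L + 1\<close> and mass up to \<open>B\<close> the Hamiltonian is
  at most \<open>K - 1\<close>; the extra \<open>1\<close> makes barriers strict and gives
  \<open>1 \<le> K\<close>.\<close>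

definition K where "K = (L + 1) powr \<alpha> * B + 1"

lemma K_ge_1: "1 \<le> K" using B_nonneg by (simp add: K_def)

text \<open>A smoothed cone of slope \<open>L + 1\<close> moving down at speed \<open>K\<close> is a strict barrier.\<close>

lemma m_ge_m0:
  assumes t0: "0 \<le> t0" and r0: "0 \<le> r0"
  shows "m0 r0 - K * t0 \<le> m t0 r0"
proof (rule field_le_epsilon)
  fix e :: real
  assume e: "0 < e"
  define l where "l = L + 1"
  have l: "1 \<le> l" "L \<le> l" using L_nonneg by (auto simp: l_def)
  \<comment> \<open>The rounded tip has height \<open>l * d = e\<close> at \<open>r0\<close>, the
    error allowed here.\<close>
  define d where "d = e / l"
  have d: "0 < d" "l * d = e" using e l by (auto simp: d_def)
  let ?s = "\<lambda>r. sqrt ((r - r0)\<^sup>2 + d\<^sup>2)"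
  have s: "\<bar>r - r0\<bar> \<le> ?s r" for r by (intro real_le_rsqrt) simp
  have KD: "((\<lambda>t. K * t) has_real_derivative K) (at t)" for t
    by (auto intro!: derivative_eq_intros)
  \<comment> \<open>Both penalties grow at least with slope 1, so a margin of \<open>B + 1\<close>
    makes them exceed \<open>m0 r0 \<le> B\<close> on the far sides.\<close>
  obtain t r where tr: "0 \<le> t" "t \<le> t0 + B + 1" "0 \<le> r" "r \<le> r0 + B + 1"
    and mn: "\<forall>s\<in>{0..t0 + B + 1}. \<forall>q\<in>{0..r0 + B + 1}.
      m t r + K * t + l * ?s r \<le> m s q + K * s + l * ?s q"
    and alt: "t = 0 \<or> t = t0 + B + 1 \<or> r = 0 \<or> r = r0 + B + 1 \<or>
      K \<le> (max (- (l * ((r - r0) / ?s r))) 0) powr \<alpha> * m t r"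
    using m_min[OF KD smooth_cone_DERIV[OF d(1)], of "t0 + B + 1" "r0 + B + 1" l r0] t0 r0 B_nonneg
    by auto
  have val: "m t r + K * t + l * ?s r \<le> m t0 r0 + K * t0 + e"
    using mn[rule_format, of t0 r0] t0 r0 d B_nonneg by simp
  have m: "0 \<le> m t r" using m_nonneg tr by simp
  have m0: "0 \<le> m0 r0" "m0 r0 \<le> B" using m0_nonneg m0_le r0 by auto
  have Kt: "t \<le> K * t" using K_ge_1 tr mult_right_mono[of 1 K t] by simp
  have ls: "\<bar>r - r0\<bar> \<le> l * ?s r"
    using mult_mono[OF l(1) s[of r]] l by simp
  have L_ls: "L * \<bar>r - r0\<bar> \<le> l * ?s r"
    using mult_mono[OF l(2) s[of r]] l by simp
  \<comment> \<open>Excludes an interior minimum: the slope there is at most \<open>l\<close>. What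
    remains are the sides, where the claim holds directly.\<close>
  have "(max (- (l * ((r - r0) / ?s r))) 0) powr \<alpha> * m t r < K"
  proof -
    have "- (l * ((r - r0) / ?s r)) \<le> l"
    proof -
      have "0 < ?s r" using d by (simp add: add_nonneg_pos)
      then have "(r0 - r) / ?s r \<le> 1" using s[of r] divide_le_eq_1_pos[of "?s r" "r0 - r"] by linarith
      then have "- ((r - r0) / ?s r) \<le> 1" by (simp add: minus_divide_left)
      then show ?thesis using l mult_left_mono[of "- ((r - r0) / ?s r)" 1 l] by simp
    qed
    then have "(max (- (l * ((r - r0) / ?s r))) 0) powr \<alpha> \<le> l powr \<alpha>"
      using l alpha by (intro powr_mono2) auto
    then have "(max (- (l * ((r - r0) / ?s r))) 0) powr \<alpha> * m t r \<le> l powr \<alpha> * B"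
      using m m_le_B tr by (intro mult_mono) auto
    then show ?thesis by (simp add: K_def l_def)
  qed
  with alt have "t = 0 \<or> t = t0 + B + 1 \<or> r = 0 \<or> r = r0 + B + 1" by linarith
  then have "m0 r0 \<le> m t r + K * t + l * ?s r"
  proof (elim disjE)
    assume "t = 0"
    then show ?thesis using m0_diff_le[OF r0 tr(3)] m_initial tr L_ls by (simp add: abs_minus_commute)
  next
    assume "t = t0 + B + 1"
    then show ?thesis using Kt ls m m0 t0 abs_ge_zero[of "r - r0"] by linarith
  next
    assume "r = 0"
    then show ?thesis using m0_diff_le[of r0 0] m0_zero L_ls r0 Kt tr m by simp
  next
    assume "r = r0 + B + 1"
    then show ?thesis using Kt ls m m0 tr by linarith
  qed
  then show "m0 r0 - K * t0 \<le> m t0 r0 + e" using val by linarith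
qed

end

section \<open>The monotone scheme\<close>

text \<open>\<open>L_pos\<close> excludes the zero datum, which is treated separately at the end,
  and makes \<open>H_lip\<close> positive.\<close>

locale mass_scheme = mass_problem +
  fixes ht hr :: real
  assumes ht: "0 < ht" and hr: "0 < hr"
    and cfl: "CFL \<alpha> m0 ht hr"
    and L_pos: "0 < lip_const m0"
begin

section \<open>The truncated Hamiltonian\<close>

abbreviation "H \<equiv> Hfun \<alpha> m0"
abbreviation "M \<equiv> schemeM \<alpha> m0 ht hr"

text \<open>A Lipschitz constant of \<open>H\<close>, because truncation caps the slope at
  \<open>L\<close>; the same factor occurs in \<open>CFL\<close>.\<close>

definition "H_lip = \<alpha> * L powr (\<alpha> - 1)"

lemma H_lip_nonneg: "0 \<le> H_lip" using alpha by (simp add: H_lip_def)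

lemma CFL_H_lip: "2 * (ht * H_lip * B) \<le> hr"
  using cfl by (simp add: CFL_def H_lip_def mult_ac)

lemma H_nonneg: "0 \<le> H s" by (simp add: Hfun_def)

lemma H_mono: "s \<le> s' \<Longrightarrow> H s \<le> H s'"
  unfolding Hfun_def using alpha L_nonneg by (intro powr_mono2) auto

lemma H_le: "H s \<le> L powr \<alpha>"
  unfolding Hfun_def using alpha L_nonneg by (intro powr_mono2) auto

lemma H_le_powr: "H s \<le> (max s 0) powr \<alpha>"
  unfolding Hfun_def using alpha L_nonneg by (intro powr_mono2) auto

lemma H_eq_powr: "s \<le> L \<Longrightarrow> H s = (max s 0) powr \<alpha>"
  unfolding Hfun_def using L_nonneg by (simp add: min_absorb1)

text \<open>Truncation to \<open>[0, L]\<close> is 1-Lipschitz, and the power has Lipschitz constant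
  \<open>H_lip\<close> there. If \<open>s'\<close> lies far below \<open>s\<close>, monotonicity
  suffices.\<close>

lemma H_le_add:
  assumes "s' \<le> s + d" "0 \<le> d"
  shows "H s' \<le> H s + H_lip * d"
proof -
  let ?c = "\<lambda>s. min (max s 0) L"
  have "H (s + d) - H s \<le> H_lip * (?c (s + d) - ?c s)"
    unfolding Hfun_def H_lip_def using alpha L_nonneg assms(2) by (intro powr_diff_le) auto
  also have "\<dots> \<le> H_lip * d" using H_lip_nonneg assms(2) by (intro mult_left_mono) auto
  finally show ?thesis using H_mono[OF assms(1)] by linarith
qed

text \<open>One step of the scheme, \<open>a\<close> being the value at the node and
  \<open>b\<close> that at its left neighbour. Real arguments allow values of the penalised solution
  to be inserted.\<close>

definition G where "G a b = a / (1 + ht * H ((a - b) / hr))"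

lemma G_denom_ge_1: "1 \<le> 1 + ht * H s" using ht H_nonneg by simp

lemma M_Suc: "M (Suc n) (Suc j) = G (M n (Suc j)) (M n j)"
  by (simp add: G_def)

lemma G_nonneg: "0 \<le> a \<Longrightarrow> 0 \<le> G a b"
  unfolding G_def using G_denom_ge_1[of "(a - b) / hr"] by simp

lemma G_le: "0 \<le> a \<Longrightarrow> G a b \<le> a"
  unfolding G_def using G_denom_ge_1[of "(a - b) / hr"] mult_left_mono[of 1 "1 + ht * H ((a - b) / hr)" a]
  by (simp add: divide_le_eq)

text \<open>This is where the CFL condition enters. Only the smaller argument needs to be at most \<open>B\<close>.\<close>

lemma G_mono:
  assumes a: "0 \<le> a" "a \<le> x" "a \<le> B" and b: "b \<le> y"
  shows "G a b \<le> G x y"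
proof -
  let ?Hx = "H ((x - y) / hr)" and ?Ha = "H ((a - b) / hr)"
  have "(x - y) / hr \<le> (a - b) / hr + (x - a) / hr"
    using b hr by (simp add: add_divide_distrib[symmetric] divide_right_mono)
  then have "?Hx \<le> ?Ha + H_lip * ((x - a) / hr)" using a hr by (intro H_le_add) auto
  then have "a * ht * ?Hx \<le> a * ht * (?Ha + H_lip * ((x - a) / hr))"
    using a ht by (intro mult_left_mono) auto
  also have "\<dots> = a * (ht * ?Ha) + (a * (ht * H_lip) / hr) * (x - a)" by (simp add: field_simps)
  \<comment> \<open>\<open>CFL\<close> bounds the coefficient of \<open>x - a\<close> by 1, so the
    growth of the numerator absorbs that of the denominator.\<close>
  also have "\<dots> \<le> x * (ht * ?Ha) + 1 * (x - a)"
  proof (intro add_mono mult_right_mono)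
    have "a * (ht * H_lip) \<le> B * (ht * H_lip)"
      using a ht H_lip_nonneg by (intro mult_right_mono) auto
    also have "\<dots> \<le> hr" using CFL_H_lip hr by (simp add: mult_ac)
    finally show "a * (ht * H_lip) / hr \<le> 1" using hr by simp
  qed (use a ht H_nonneg in auto)
  finally have "a * (1 + ht * ?Hx) \<le> x * (1 + ht * ?Ha)" by (simp add: algebra_simps)
  moreover have "0 < 1 + ht * ?Hx" "0 < 1 + ht * ?Ha"
    using G_denom_ge_1[of "(x - y) / hr"] G_denom_ge_1[of "(a - b) / hr"] by linarith+
  ultimately show ?thesis unfolding G_def by (simp add: pos_divide_le_eq pos_le_divide_eq)
qed

text \<open>By monotonicity \<open>a\<close> may be raised to \<open>b + L * hr\<close>, where the
  slope is exactly \<open>L\<close> and the damping at least that of the neighbour. The neighbour's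
  damping then only shrinks the increment \<open>L * hr\<close>. The raised value may exceed
  \<open>B\<close>, which \<open>G_mono\<close> allows.\<close>

lemma G_step:
  assumes b: "0 \<le> b" and a: "0 \<le> a" "a \<le> B" "a \<le> b + L * hr" and d: "b - d \<le> L * hr"
  shows "G a b \<le> G b d + L * hr"
proof -
  have Lh: "0 \<le> L * hr" using L_nonneg hr by simp
  have "G a b \<le> G (b + L * hr) b" using a by (intro G_mono) auto
  also have "\<dots> = (b + L * hr) / (1 + ht * H L)" using hr by (simp add: G_def)
  also have "\<dots> \<le> (b + L * hr) / (1 + ht * H ((b - d) / hr))"
    using G_denom_ge_1[of L] G_denom_ge_1[of "(b - d) / hr"] b Lh ht d hr
    by (intro divide_left_mono add_left_mono mult_left_mono H_mono) (auto simp: divide_le_eq intro!: mult_pos_pos)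
  also have "\<dots> = G b d + L * hr / (1 + ht * H ((b - d) / hr))" by (simp add: G_def add_divide_distrib)
  also have "L * hr / (1 + ht * H ((b - d) / hr)) \<le> L * hr"
    using G_denom_ge_1[of "(b - d) / hr"] Lh mult_left_mono[of 1 "1 + ht * H ((b - d) / hr)" "L * hr"]
    by (simp add: divide_le_eq)
  finally show ?thesis by simp
qed

section \<open>Bounds and slopes of the grid values\<close>

lemma M_zero: "M n 0 = 0" by (cases n) (auto simp: m0_zero)

text \<open>\<open>G_mono\<close> and \<open>G_step\<close> need bounds, order and slopes of level
  \<open>n\<close> at once, hence the joint induction. The first cell is separate because its left
  value is imposed, not computed by \<open>G\<close>.\<close>

lemma M_invariants:
  "0 \<le> M n j \<and> M n j \<le> B \<and> M n j \<le> M n (Suc j) \<and> M n (Suc j) \<le> M n j + L * hr"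
proof (induction n arbitrary: j)
  case 0
  have "0 \<le> real j * hr" "0 \<le> real (Suc j) * hr" "real j * hr \<le> real (Suc j) * hr" using hr by auto
  moreover have "\<bar>real (Suc j) * hr - real j * hr\<bar> = hr" using hr by (simp add: algebra_simps)
  ultimately show ?case
    using m0_nonneg[of "real j * hr"] m0_le[of "real j * hr"]
      mono_onD[OF m0_mono, of "real j * hr" "real (Suc j) * hr"]
      m0_diff_le[of "real (Suc j) * hr" "real j * hr"] by (auto simp del: of_nat_Suc)
next
  case (Suc n)
  have bd: "0 \<le> M (Suc n) j \<and> M (Suc n) j \<le> B" for j
  proof (cases j)
    case (Suc i)
    then show ?thesis
      using G_nonneg[of "M n j"] G_le[of "M n j"] Suc.IH[of j] order_trans unfolding Suc M_Suc by blast
  qed (simp add: B_nonneg)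
  show ?case
  proof (cases j)
    case 0
    have "M (Suc n) (Suc 0) \<le> M n (Suc 0)" unfolding M_Suc using Suc.IH[of "Suc 0"] by (intro G_le) auto
    then show ?thesis using 0 bd[of 0] bd[of "Suc 0"] Suc.IH[of 0] M_zero by simp
  next
    case (Suc i)
    have "G (M n (Suc i)) (M n i) \<le> G (M n (Suc (Suc i))) (M n (Suc i))"
      using Suc.IH[of i] Suc.IH[of "Suc i"] by (intro G_mono) auto
    moreover have "G (M n (Suc (Suc i))) (M n (Suc i)) \<le> G (M n (Suc i)) (M n i) + L * hr"
      using Suc.IH[of i] Suc.IH[of "Suc i"] Suc.IH[of "Suc (Suc i)"] by (intro G_step) auto
    ultimately show ?thesis using bd[of j] unfolding Suc M_Suc by blast
  qed
qed

lemma M_nonneg: "0 \<le> M n j" and M_le_B: "M n j \<le> B" and M_lip: "M n (Suc j) \<le> M n j + L * hr"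
  using M_invariants by blast+

lemma M_le_m0: "M n j \<le> m0 (real j * hr)"
proof (induction n)
  case (Suc n)
  then show ?case
    using M_zero m0_zero M_Suc G_le[OF M_nonneg] by (cases j) (force intro: order_trans)+
qed simp

text \<open>This is \<open>1 - h \<le> 1 / (1 + h)\<close>.\<close>

lemma G_ge:
  assumes "0 \<le> a"
  shows "a - a * (ht * H ((a - b) / hr)) \<le> G a b"
proof -
  let ?h = "ht * H ((a - b) / hr)"
  have h: "0 \<le> ?h" using ht H_nonneg by simp
  have "(a - a * ?h) * (1 + ?h) = a - a * ?h\<^sup>2" by (simp add: algebra_simps power2_eq_square)
  also have "\<dots> \<le> a" using assms by simp
  finally show ?thesis unfolding G_def using h by (simp add: pos_le_divide_eq)
qed

text \<open>Discrete counterpart of \<open>m_ge_m0\<close> with the same \<open>K\<close>: one step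
  loses at most \<open>B * (ht * L powr \<alpha>) \<le> K * ht\<close>.\<close>

lemma M_ge_m0: "m0 (real j * hr) - K * (real n * ht) \<le> M n j"
proof (induction n)
  case (Suc n)
  have "M n j - K * ht \<le> M (Suc n) j"
  proof (cases j)
    case 0
    then show ?thesis using M_zero[of n] K_ge_1 ht by simp
  next
    case (Suc i)
    have "M n j * (ht * H ((M n j - M n i) / hr)) \<le> B * (ht * L powr \<alpha>)"
      using M_nonneg M_le_B H_le H_nonneg ht B_nonneg by (intro mult_mono) auto
    also have "\<dots> \<le> B * (ht * (L + 1) powr \<alpha>)"
      using ht B_nonneg L_nonneg alpha by (intro mult_left_mono powr_mono2) auto
    also have "\<dots> \<le> K * ht" using ht by (simp add: K_def algebra_simps)
    finally show ?thesis
      using G_ge[OF M_nonneg, of n j "M n i"] unfolding Suc M_Suc by linarith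
  qed
  with Suc show ?case by (simp add: algebra_simps)
qed simp

section \<open>Comparison and error estimate\<close>

text \<open>Doubling of variables with the scheme variables frozen: at the maximal point the slopes of the
  parabola are admissible in the equation, and the same point tested against the grid points
  \<open>(n, j)\<close> and \<open>(n, j - 1)\<close> gives lower bounds for the two values entering the scheme.\<close>

lemma scheme_lower_bound:
  assumes \<epsilon>: "0 < \<epsilon>" and E0: "K\<^sup>2 * \<epsilon> / 2 + L\<^sup>2 * \<epsilon> / 2 \<le> E0"
    and err: "ht / (2 * \<epsilon>) + B * (H_lip * (hr / (2 * \<epsilon>))) \<le> err"
    and "0 \<le> t" "0 \<le> r"
  shows "m t r - (t - real n * ht)\<^sup>2 / (2 * \<epsilon>) - (r - real j * hr)\<^sup>2 / (2 * \<epsilon>)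
    \<le> M n j + E0 + real n * ht * err"
  using \<open>0 \<le> t\<close> \<open>0 \<le> r\<close>
proof (induction n arbitrary: j t r)
  case 0
  have "m t r \<le> m0 (real j * hr) + L * \<bar>r - real j * hr\<bar>"
    using m_le_m0[OF 0] m0_diff_le[of r "real j * hr"] 0 hr by simp
  also have "\<dots> \<le> m0 (real j * hr) + ((r - real j * hr)\<^sup>2 / (2 * \<epsilon>) + L\<^sup>2 * \<epsilon> / 2)"
    using young_le[OF \<epsilon>, of L "\<bar>r - real j * hr\<bar>"] by simp
  moreover have "0 \<le> K\<^sup>2 * \<epsilon> / 2" "0 \<le> (t - 0)\<^sup>2 / (2 * \<epsilon>)" using \<epsilon> by auto
  ultimately have "m t r - (t - 0)\<^sup>2 / (2 * \<epsilon>) - (r - real j * hr)\<^sup>2 / (2 * \<epsilon>)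
    \<le> m0 (real j * hr) + E0"
    using E0 by linarith
  then show ?case by simp
next
  case (Suc n)
  define s where "s = real n * ht + ht"
  define E where "E = E0 + real n * ht * err"
  have s: "real (Suc n) * ht = s" "0 \<le> s" using ht by (auto simp: s_def algebra_simps)
  have err0: "ht / (2 * \<epsilon>) \<le> err" "0 \<le> err"
  proof -
    have "0 \<le> ht / (2 * \<epsilon>)" "0 \<le> B * (H_lip * (hr / (2 * \<epsilon>)))"
      using ht hr \<epsilon> B_nonneg H_lip_nonneg by auto
    then show "ht / (2 * \<epsilon>) \<le> err" "0 \<le> err" using err by linarith+
  qed
  have KL: "0 \<le> K\<^sup>2 * \<epsilon> / 2" "0 \<le> L\<^sup>2 * \<epsilon> / 2" using \<epsilon> by auto
  have E: "E0 \<le> E" "0 \<le> E0" using E0 KL ht err0 by (auto simp: E_def)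
  have hterr: "0 \<le> ht * err" using ht err0 by simp
  have "m t r - (t - s)\<^sup>2 / (2 * \<epsilon>) - (r - real j * hr)\<^sup>2 / (2 * \<epsilon>) \<le> M (Suc n) j + E + ht * err"
  proof (cases j)
    case 0
    have "m t r \<le> L * r"
      using m_le_m0[OF Suc.prems] m0_diff_le[of r 0] m0_zero Suc.prems by simp
    also have "\<dots> \<le> r\<^sup>2 / (2 * \<epsilon>) + L\<^sup>2 * \<epsilon> / 2" by (rule young_le[OF \<epsilon>])
    finally have "m t r \<le> r\<^sup>2 / (2 * \<epsilon>) + L\<^sup>2 * \<epsilon> / 2" .
    moreover have "0 \<le> (t - s)\<^sup>2 / (2 * \<epsilon>)" using \<epsilon> by simp
    ultimately have "m t r - (t - s)\<^sup>2 / (2 * \<epsilon>) - r\<^sup>2 / (2 * \<epsilon>) \<le> 0 + E + ht * err"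
      using E0 E KL hterr by linarith
    then show ?thesis using 0 by simp
  next
    case j: (Suc i)
    define q where "q = real j * hr"
    have q: "0 \<le> q" "real i * hr = q - hr" using hr by (auto simp: q_def j algebra_simps)
    \<comment> \<open>By \<open>le_parabola\<close>, a penalty at distance at least \<open>D\<close>
      is at least \<open>B\<close> and outweighs \<open>m\<close>.\<close>
    define D where "D = 2 * \<epsilon> * B + 1"
    have D: "0 \<le> D" using \<epsilon> B_nonneg by (simp add: D_def)
    obtain t' r' where tr: "0 \<le> t'" "0 \<le> r'"
      and mx: "\<forall>x\<in>{0..max t (s + D)}. \<forall>y\<in>{0..max r (q + D)}.
        m x y - (x - s)\<^sup>2 / (2 * \<epsilon>) - (y - q)\<^sup>2 / (2 * \<epsilon>)
          \<le> m t' r' - (t' - s)\<^sup>2 / (2 * \<epsilon>) - (r' - q)\<^sup>2 / (2 * \<epsilon>)"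
      and alt: "t' = 0 \<or> t' = max t (s + D) \<or> r' = 0 \<or> r' = max r (q + D) \<or>
        (t' - s) / \<epsilon> + (max ((r' - q) / \<epsilon>) 0) powr \<alpha> * m t' r' \<le> 0"
      using m_max[OF parabola_DERIV parabola_DERIV, of "max t (s + D)" "max r (q + D)" s \<epsilon> q \<epsilon>]
        s q D by (auto simp: le_max_iff_disj)
    have m': "0 \<le> m t' r'" "m t' r' \<le> B" "m t' r' \<le> m0 r'"
      using m_nonneg m_le_B m_le_m0 tr by auto
    define V where "V = m t' r' - (t' - s)\<^sup>2 / (2 * \<epsilon>) - (r' - q)\<^sup>2 / (2 * \<epsilon>)"
    have sq: "0 \<le> (t' - s)\<^sup>2 / (2 * \<epsilon>)" "0 \<le> (r' - q)\<^sup>2 / (2 * \<epsilon>)" using \<epsilon> by auto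
    have M: "0 \<le> M (Suc n) j" using M_nonneg .
    from alt have "V \<le> M (Suc n) j + E + ht * err"
    proof (elim disjE)
      assume "t' = 0"
      then have "m t' r' \<le> m0 q + L * \<bar>r' - q\<bar>" using m_initial m0_diff_le[OF tr(2) q(1)] tr by simp
      moreover have "L * \<bar>r' - q\<bar> \<le> (r' - q)\<^sup>2 / (2 * \<epsilon>) + L\<^sup>2 * \<epsilon> / 2"
        using young_le[OF \<epsilon>, of L "\<bar>r' - q\<bar>"] by simp
      \<comment> \<open>At \<open>t' = 0\<close> the time parabola pays for the decay
        \<open>K * s\<close> of the scheme.\<close>
      moreover have "K * s \<le> (t' - s)\<^sup>2 / (2 * \<epsilon>) + K\<^sup>2 * \<epsilon> / 2"
        using young_le[OF \<epsilon>, of K s] \<open>t' = 0\<close> by simp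
      moreover have "m0 q - K * s \<le> M (Suc n) j"
        using M_ge_m0[of j "Suc n"] unfolding s(1) q_def .
      ultimately show ?thesis using E0 E hterr unfolding V_def by linarith
    next
      assume "t' = max t (s + D)"
      then have "B \<le> (t' - s)\<^sup>2 / (2 * \<epsilon>)"
        using B_nonneg by (intro le_parabola[OF \<epsilon>]) (auto simp: D_def)
      then show ?thesis using sq m' M E hterr unfolding V_def by linarith
    next
      assume "r' = 0"
      then have "m t' r' = 0" using m_boundary tr by simp
      then show ?thesis using sq M E hterr unfolding V_def by linarith
    next
      assume "r' = max r (q + D)"
      then have "B \<le> (r' - q)\<^sup>2 / (2 * \<epsilon>)"
        using B_nonneg by (intro le_parabola[OF \<epsilon>]) (auto simp: D_def)
      then show ?thesis using sq m' M E hterr unfolding V_def by linarith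
    next
      define pt pr where "pt = (t' - s) / \<epsilon>" and "pr = (r' - q) / \<epsilon>"
      \<comment> \<open>The exact difference quotient of the spatial parabola between the nodes
        \<open>i\<close> and \<open>j\<close>; it deviates from the derivative \<open>pr\<close> by
        \<open>hr / (2 * \<epsilon>)\<close>.\<close>
      define p where "p = pr + hr / (2 * \<epsilon>)"
      assume "(t' - s) / \<epsilon> + (max ((r' - q) / \<epsilon>) 0) powr \<alpha> * m t' r' \<le> 0"
      then have eq: "pt + (max pr 0) powr \<alpha> * m t' r' \<le> 0" by (simp add: pt_def pr_def)
      define A where "A = m t' r' - (t' - real n * ht)\<^sup>2 / (2 * \<epsilon>) - (r' - q)\<^sup>2 / (2 * \<epsilon>)"
      define x where "x = A - E"
      have xa: "x \<le> M n j"
        using Suc.IH[OF tr, of j] unfolding x_def A_def E_def q_def by linarith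
      have "A - hr * p = m t' r' - (t' - real n * ht)\<^sup>2 / (2 * \<epsilon>) - (r' - real i * hr)\<^sup>2 / (2 * \<epsilon>)"
        using \<epsilon> unfolding A_def p_def pr_def q(2) by (simp add: field_simps power2_eq_square)
      then have xb: "x - hr * p \<le> M n i"
        using Suc.IH[OF tr, of i] unfolding x_def E_def by linarith
      \<comment> \<open>Moving the centre from level \<open>n\<close> to \<open>Suc n\<close>
        changes the time parabola by its derivative term and an exact second-order
        remainder.\<close>
      have VA: "V = x + E + ht * pt + ht * (ht / (2 * \<epsilon>))"
        using \<epsilon> unfolding V_def x_def A_def pt_def s_def by (simp add: field_simps power2_eq_square)
      have pt: "pt \<le> 0"
      proof -
        have "0 \<le> (max pr 0) powr \<alpha> * m t' r'" using m' by simp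
        with eq show ?thesis by linarith
      qed
      show ?thesis
      \<comment> \<open>\<open>G_mono\<close> needs a nonnegative smaller argument; for negative
        \<open>x\<close> the claim follows from \<open>0 \<le> M (Suc n) j\<close> and
        \<open>pt \<le> 0\<close>.\<close>
      proof (cases "0 \<le> x")
        case False
        have "ht * pt \<le> 0" "ht * (ht / (2 * \<epsilon>)) \<le> ht * err"
          using ht pt mult_left_mono[OF err0(1), of ht] by (simp_all add: mult_le_0_iff)
        then show ?thesis using VA False M by linarith
      next
        case True
        have xm: "x \<le> m t' r'"
        proof -
          have "0 \<le> (t' - real n * ht)\<^sup>2 / (2 * \<epsilon>)" using \<epsilon> by simp
          then show ?thesis using sq E unfolding x_def A_def by linarith
        qed
        have "x - x * (ht * H p) \<le> G x (x - hr * p)"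
          using G_ge[OF True, of "x - hr * p"] hr by simp
        also have "\<dots> \<le> M (Suc n) j"
          unfolding j M_Suc using True xa xb M_le_B[of n j] by (intro G_mono) (auto simp: j)
        finally have G: "x - ht * (x * H p) \<le> M (Suc n) j" by (simp add: mult_ac)
        have "x * H p \<le> m t' r' * H p" using xm H_nonneg by (intro mult_right_mono)
        \<comment> \<open>Truncation has the favourable sign here: \<open>H pr\<close> is at most
          the full power in the equation.\<close>
        also have "\<dots> \<le> m t' r' * ((max pr 0) powr \<alpha> + H_lip * (hr / (2 * \<epsilon>)))"
          using H_le_add[of p pr "hr / (2 * \<epsilon>)"] H_le_powr[of pr] hr \<epsilon> m'
          by (intro mult_left_mono) (auto simp: p_def)
        also have "\<dots> = (max pr 0) powr \<alpha> * m t' r' + m t' r' * (H_lip * (hr / (2 * \<epsilon>)))"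
          by (simp add: algebra_simps)
        also have "\<dots> \<le> - pt + B * (H_lip * (hr / (2 * \<epsilon>)))"
          using eq m' H_lip_nonneg hr \<epsilon> by (intro add_mono mult_right_mono) auto
        finally have "x * H p + pt + ht / (2 * \<epsilon>) \<le> err" using err by linarith
        then have "ht * (x * H p + pt + ht / (2 * \<epsilon>)) \<le> ht * err" using ht by simp
        then show ?thesis using VA G by (simp add: distrib_left)
      qed
    qed
    moreover have "m t r - (t - s)\<^sup>2 / (2 * \<epsilon>) - (r - q)\<^sup>2 / (2 * \<epsilon>) \<le> V"
      using mx Suc.prems unfolding V_def by auto
    ultimately show ?thesis unfolding q_def by linarith
  qed
  moreover have "E + ht * err = E0 + s * err" by (simp add: E_def s_def algebra_simps)
  ultimately show ?case unfolding s(1) by linarith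
qed

text \<open>The equation sees the full power \<open>p powr \<alpha>\<close> whereas the scheme truncates it at slope \<open>L\<close>. If the
  slope of the parabola exceeds \<open>L + hr / (2 * \<epsilon>)\<close>, the Lipschitz bound of the scheme reduces the claim
  at \<open>(n, j)\<close> to the one at \<open>(n, j - 1)\<close> without any loss; hence the inner induction on \<open>j\<close>.\<close>

lemma scheme_upper_bound:
  assumes \<epsilon>: "0 < \<epsilon>" "hr \<le> 2 * \<epsilon>" and E0: "K\<^sup>2 * \<epsilon> / 2 + L\<^sup>2 * \<epsilon> / 2 \<le> E0"
    and err: "ht / (2 * \<epsilon>) + B * (ht * (L powr \<alpha>)\<^sup>2)
      + B * (\<alpha> * (L + 1) powr (\<alpha> - 1) * (hr / (2 * \<epsilon>))) \<le> err"
    and "0 \<le> t" "0 \<le> r"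
  shows "M n j \<le> m t r + (t - real n * ht)\<^sup>2 / (2 * \<epsilon>) + (r - real j * hr)\<^sup>2 / (2 * \<epsilon>)
    + E0 + real n * ht * err"
  using \<open>0 \<le> t\<close> \<open>0 \<le> r\<close>
proof (induction n arbitrary: j t r)
  case 0
  have "m0 (real j * hr) \<le> m0 r + L * \<bar>r - real j * hr\<bar>"
    using m0_diff_le[of "real j * hr" r] 0 hr by (simp add: abs_minus_commute)
  moreover have "m0 r \<le> m t r + K * t" using m_ge_m0[OF 0] by linarith
  moreover have "L * \<bar>r - real j * hr\<bar> \<le> (r - real j * hr)\<^sup>2 / (2 * \<epsilon>) + L\<^sup>2 * \<epsilon> / 2"
    using young_le[OF \<epsilon>(1), of L "\<bar>r - real j * hr\<bar>"] by simp
  moreover have "K * t \<le> t\<^sup>2 / (2 * \<epsilon>) + K\<^sup>2 * \<epsilon> / 2" by (rule young_le[OF \<epsilon>(1)])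
  ultimately have "m0 (real j * hr) \<le> m t r + t\<^sup>2 / (2 * \<epsilon>) + (r - real j * hr)\<^sup>2 / (2 * \<epsilon>) + E0"
    using E0 by linarith
  then show ?case by simp
next
  case (Suc n)
  define s where "s = real n * ht + ht"
  define E where "E = E0 + real n * ht * err"
  have s: "real (Suc n) * ht = s" "0 \<le> s" using ht by (auto simp: s_def algebra_simps)
  have err0: "0 \<le> err"
  proof -
    have "0 \<le> ht / (2 * \<epsilon>) + B * (ht * (L powr \<alpha>)\<^sup>2)
      + B * (\<alpha> * (L + 1) powr (\<alpha> - 1) * (hr / (2 * \<epsilon>)))"
      using ht hr \<epsilon> B_nonneg alpha by (intro add_nonneg_nonneg mult_nonneg_nonneg) auto
    then show ?thesis using err by linarith
  qed
  have KL: "0 \<le> K\<^sup>2 * \<epsilon> / 2" "0 \<le> L\<^sup>2 * \<epsilon> / 2" using \<epsilon> by auto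
  have E: "E0 \<le> E" "0 \<le> E0" using E0 KL ht err0 by (auto simp: E_def)
  have hterr: "0 \<le> ht * err" using ht err0 by simp
  have "M (Suc n) j \<le> m t r + (t - s)\<^sup>2 / (2 * \<epsilon>) + (r - real j * hr)\<^sup>2 / (2 * \<epsilon>) + E + ht * err"
    using Suc.prems
  proof (induction j arbitrary: t r)
    case 0
    have "0 \<le> (t - s)\<^sup>2 / (2 * \<epsilon>)" "0 \<le> (r - real 0 * hr)\<^sup>2 / (2 * \<epsilon>)" using \<epsilon> by auto
    then show ?case using M_zero[of "Suc n"] m_nonneg[OF 0] E hterr by linarith
  next
    case j: (Suc i)
    define q where "q = real (Suc i) * hr"
    have q: "0 \<le> q" "real i * hr = q - hr" using hr by (auto simp: q_def algebra_simps)
    define D where "D = 2 * \<epsilon> * B + 1"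
    have D: "0 \<le> D" using \<epsilon> B_nonneg by (simp add: D_def)
    obtain t' r' where tr: "0 \<le> t'" "0 \<le> r'"
      and mn: "\<forall>x\<in>{0..max t (s + D)}. \<forall>y\<in>{0..max r (q + D)}.
        m t' r' + (t' - s)\<^sup>2 / (2 * \<epsilon>) + (r' - q)\<^sup>2 / (2 * \<epsilon>)
          \<le> m x y + (x - s)\<^sup>2 / (2 * \<epsilon>) + (y - q)\<^sup>2 / (2 * \<epsilon>)"
      and alt: "t' = 0 \<or> t' = max t (s + D) \<or> r' = 0 \<or> r' = max r (q + D) \<or>
        (t' - s) / \<epsilon> \<le> (max (- ((r' - q) / \<epsilon>)) 0) powr \<alpha> * m t' r'"
      using m_min[OF parabola_DERIV parabola_DERIV, of "max t (s + D)" "max r (q + D)" s \<epsilon> q \<epsilon>]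
        s q D by (auto simp: le_max_iff_disj)
    have m': "0 \<le> m t' r'" "m t' r' \<le> B" using m_nonneg m_le_B tr by auto
    define V where "V = m t' r' + (t' - s)\<^sup>2 / (2 * \<epsilon>) + (r' - q)\<^sup>2 / (2 * \<epsilon>)"
    have sq: "0 \<le> (t' - s)\<^sup>2 / (2 * \<epsilon>)" "0 \<le> (r' - q)\<^sup>2 / (2 * \<epsilon>)" using \<epsilon> by auto
    have MB: "M (Suc n) (Suc i) \<le> B" using M_le_B .
    have Mm0: "M (Suc n) (Suc i) \<le> m0 q" unfolding q_def by (rule M_le_m0)
    from alt have "M (Suc n) (Suc i) \<le> V + E + ht * err"
    proof (elim disjE)
      assume "t' = 0"
      then have "m0 q \<le> m t' r' + L * \<bar>r' - q\<bar>"
        using m_initial m0_diff_le[OF q(1) tr(2)] tr by (simp add: abs_minus_commute)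
      moreover have "L * \<bar>r' - q\<bar> \<le> (r' - q)\<^sup>2 / (2 * \<epsilon>) + L\<^sup>2 * \<epsilon> / 2"
        using young_le[OF \<epsilon>(1), of L "\<bar>r' - q\<bar>"] by simp
      ultimately show ?thesis using Mm0 sq KL E0 E hterr unfolding V_def by linarith
    next
      assume "t' = max t (s + D)"
      then have "B \<le> (t' - s)\<^sup>2 / (2 * \<epsilon>)"
        using B_nonneg by (intro le_parabola[OF \<epsilon>(1)]) (auto simp: D_def)
      then show ?thesis using sq m' MB E hterr unfolding V_def by linarith
    next
      assume r': "r' = 0"
      then have "m0 q \<le> L * q" using m0_diff_le[OF q(1), of 0] q m0_zero by simp
      also have "\<dots> \<le> (r' - q)\<^sup>2 / (2 * \<epsilon>) + L\<^sup>2 * \<epsilon> / 2"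
        using young_le[OF \<epsilon>(1), of L q] r' by simp
      finally show ?thesis using sq m' Mm0 KL E0 E hterr unfolding V_def by linarith
    next
      assume "r' = max r (q + D)"
      then have "B \<le> (r' - q)\<^sup>2 / (2 * \<epsilon>)"
        using B_nonneg by (intro le_parabola[OF \<epsilon>(1)]) (auto simp: D_def)
      then show ?thesis using sq m' MB E hterr unfolding V_def by linarith
    next
      define pt pr where "pt = (t' - s) / \<epsilon>" and "pr = - ((r' - q) / \<epsilon>)"
      \<comment> \<open>The penalties are now added, so the difference quotient of the parabola
        enters with the opposite sign.\<close>
      define p where "p = pr - hr / (2 * \<epsilon>)"
      assume "(t' - s) / \<epsilon> \<le> (max (- ((r' - q) / \<epsilon>)) 0) powr \<alpha> * m t' r'"
      then have eq: "pt \<le> (max pr 0) powr \<alpha> * m t' r'" by (simp add: pt_def pr_def)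
      have shift: "(r' - real i * hr)\<^sup>2 / (2 * \<epsilon>) = (r' - q)\<^sup>2 / (2 * \<epsilon>) - hr * p"
        using \<epsilon> unfolding p_def pr_def q(2) by (simp add: field_simps power2_eq_square)
      show ?thesis
      proof (cases "p \<le> L")
        case False
        then have "hr * L \<le> hr * p" using hr by (intro mult_left_mono) auto
        then show ?thesis
          using j.IH[OF tr] M_lip[of "Suc n" i] unfolding V_def shift by (simp add: mult.commute)
      next
        case True
        define A where "A = m t' r' + (t' - real n * ht)\<^sup>2 / (2 * \<epsilon>) + (r' - q)\<^sup>2 / (2 * \<epsilon>)"
        define x where "x = A + E"
        have ax: "M n (Suc i) \<le> x"
          using Suc.IH[OF tr, of "Suc i"] unfolding x_def A_def E_def q_def by linarith
        have bx: "M n i \<le> x - hr * p"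
          using Suc.IH[OF tr, of i] unfolding x_def A_def E_def shift by linarith
        have VA: "V + E = x - ht * pt - ht * (ht / (2 * \<epsilon>))"
          using \<epsilon> unfolding V_def x_def A_def pt_def s_def by (simp add: field_simps power2_eq_square)
        have mx: "m t' r' \<le> x"
        proof -
          have "0 \<le> (t' - real n * ht)\<^sup>2 / (2 * \<epsilon>)" using \<epsilon> by simp
          then show ?thesis using sq E unfolding x_def A_def by linarith
        qed
        define h where "h = ht * H p"
        have h: "0 \<le> h" "h \<le> ht * L powr \<alpha>" using ht H_nonneg H_le by (auto simp: h_def)
        have "M (Suc n) (Suc i) \<le> G x (x - hr * p)"
          unfolding M_Suc using ax bx M_nonneg M_le_B by (intro G_mono) auto
        also have "\<dots> = x / (1 + h)" using hr by (simp add: G_def h_def)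
        \<comment> \<open>Uses \<open>h - h\<^sup>2 \<le> h / (1 + h)\<close>. Since
          \<open>x\<close> has no bound by \<open>B\<close>, the smaller \<open>m t' r'\<close>
          replaces it in the damping term, which keeps the quadratic error bounded.\<close>
        also have "\<dots> \<le> x - m t' r' * (h - h\<^sup>2)"
        proof -
          have "m t' r' * (h - h\<^sup>2) * (1 + h) = m t' r' * h - m t' r' * h ^ 3"
            by (simp add: algebra_simps power2_eq_square power3_eq_cube)
          also have "\<dots> \<le> m t' r' * h" using m' h by simp
          also have "\<dots> \<le> x * h" using mx h by (intro mult_right_mono)
          finally have "x \<le> x + x * h - m t' r' * (h - h\<^sup>2) * (1 + h)" by linarith
          also have "\<dots> = (x - m t' r' * (h - h\<^sup>2)) * (1 + h)" by (simp add: algebra_simps)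
          finally show ?thesis using h by (simp add: pos_divide_le_eq)
        qed
        finally have G: "M (Suc n) (Suc i) \<le> x - m t' r' * h + m t' r' * h\<^sup>2"
          by (simp add: algebra_simps)
        have "m t' r' * h\<^sup>2 \<le> B * (ht * L powr \<alpha>)\<^sup>2"
          using m' h by (intro mult_mono power_mono) auto
        also have "\<dots> = ht * (B * (ht * (L powr \<alpha>)\<^sup>2))" by (simp add: power2_eq_square)
        finally have G2: "m t' r' * h\<^sup>2 \<le> ht * (B * (ht * (L powr \<alpha>)\<^sup>2))" .
        \<comment> \<open>\<open>hr \<le> 2 * \<epsilon>\<close> gives
          \<open>pr \<le> L + 1\<close>, the origin of the factor
          \<open>(L + 1) powr (\<alpha> - 1)\<close> in \<open>err\<close>.\<close>
        have "0 \<le> hr / (2 * \<epsilon>)" "hr / (2 * \<epsilon>) \<le> 1" using \<epsilon> hr by auto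
        then have pr: "p \<le> pr" "pr \<le> L + 1" "pr - p = hr / (2 * \<epsilon>)" using True by (auto simp: p_def)
        have "(max pr 0) powr \<alpha> - (max p 0) powr \<alpha> \<le> \<alpha> * (L + 1) powr (\<alpha> - 1) * (max pr 0 - max p 0)"
          using alpha pr L_nonneg by (intro powr_diff_le) auto
        also have "\<dots> \<le> \<alpha> * (L + 1) powr (\<alpha> - 1) * (hr / (2 * \<epsilon>))"
          using alpha pr(1) unfolding pr(3)[symmetric] by (intro mult_left_mono) auto
        \<comment> \<open>For \<open>p \<le> L\<close> the truncation is inactive from above, so
          \<open>H p\<close> is the full power.\<close>
        finally have "(max pr 0) powr \<alpha> \<le> H p + \<alpha> * (L + 1) powr (\<alpha> - 1) * (hr / (2 * \<epsilon>))"
          using H_eq_powr[OF True] by linarith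
        then have "(max pr 0) powr \<alpha> * m t' r'
          \<le> (H p + \<alpha> * (L + 1) powr (\<alpha> - 1) * (hr / (2 * \<epsilon>))) * m t' r'"
          using m' by (intro mult_right_mono)
        also have "\<dots> = m t' r' * H p + m t' r' * (\<alpha> * (L + 1) powr (\<alpha> - 1) * (hr / (2 * \<epsilon>)))"
          by (simp add: algebra_simps)
        also have "\<dots> \<le> m t' r' * H p + B * (\<alpha> * (L + 1) powr (\<alpha> - 1) * (hr / (2 * \<epsilon>)))"
          using m' alpha hr \<epsilon> by (intro add_left_mono mult_right_mono) auto
        finally have "pt + ht / (2 * \<epsilon>) + B * (ht * (L powr \<alpha>)\<^sup>2) - m t' r' * H p \<le> err"
          using eq err by linarith
        then have "ht * (pt + ht / (2 * \<epsilon>) + B * (ht * (L powr \<alpha>)\<^sup>2) - m t' r' * H p) \<le> ht * err"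
          using ht by simp
        then have "ht * pt + ht * (ht / (2 * \<epsilon>)) + ht * (B * (ht * (L powr \<alpha>)\<^sup>2)) - m t' r' * h \<le> ht * err"
          by (simp add: h_def distrib_left right_diff_distrib mult_ac)
        then show ?thesis using VA G G2 by linarith
      qed
    qed
    moreover have "V \<le> m t r + (t - s)\<^sup>2 / (2 * \<epsilon>) + (r - q)\<^sup>2 / (2 * \<epsilon>)"
      using mn j.prems unfolding V_def by auto
    ultimately show ?case unfolding q_def by linarith
  qed
  moreover have "E + ht * err = E0 + s * err" by (simp add: E_def s_def algebra_simps)
  ultimately show ?case unfolding s(1) by linarith
qed

text \<open>Bounds the consistency error divided by \<open>\<epsilon>\<close>, with
  \<open>1 / (2 * H_lip * B)\<close> the bound on \<open>ht / hr\<close> from \<open>CFL\<close>. It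
  involves neither \<open>ht\<close> nor \<open>hr\<close>.\<close>

definition rate :: real
  where "rate = 1 / (2 * H_lip * B) * (1 + B * (L powr \<alpha>)\<^sup>2) + B * (\<alpha> * (L + 1) powr (\<alpha> - 1))"

text \<open>For \<open>\<epsilon> = sqrt hr\<close> the errors \<open>hr / \<epsilon>\<close> and
  \<open>\<epsilon>\<close> coincide; \<open>hr \<le> 1\<close> allows \<open>hr\<close> itself to
  be bounded by \<open>\<epsilon>\<close>.\<close>

lemma scheme_error:
  assumes B: "0 < B" and hr1: "hr \<le> 1" and nT: "real n * ht \<le> T"
  shows "\<bar>m (real n * ht) (real j * hr) - M n j\<bar> \<le> (K\<^sup>2 + L\<^sup>2 + T * rate) * sqrt hr"
proof -
  define \<epsilon> where "\<epsilon> = sqrt hr"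
  have \<epsilon>: "0 < \<epsilon>" "\<epsilon> \<le> 1" "hr = \<epsilon> * \<epsilon>" using hr hr1 by (auto simp: \<epsilon>_def)
  have hr_le: "hr \<le> \<epsilon>" using \<epsilon> mult_left_mono[of \<epsilon> 1 \<epsilon>] by simp
  have half: "hr / (2 * \<epsilon>) = \<epsilon> / 2" using \<epsilon> by simp
  define c where "c = 1 / (2 * H_lip * B)"
  have lip: "0 < H_lip" using alpha L_pos by (simp add: H_lip_def)
  have c: "0 < c" using lip B by (simp add: c_def)
  have ht_le: "ht \<le> c * hr"
    using CFL_H_lip lip B by (simp add: c_def pos_le_divide_eq mult_ac)
  also have "\<dots> \<le> c * \<epsilon>" using c hr_le by simp
  finally have ht\<epsilon>: "ht \<le> c * \<epsilon>" .
  have "ht / (2 * \<epsilon>) \<le> c * hr / (2 * \<epsilon>)" using ht_le \<epsilon> by (intro divide_right_mono) auto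
  also have "\<dots> = c * (\<epsilon> / 2)" using half by (metis times_divide_eq_right)
  also have "\<dots> \<le> c * \<epsilon>" using c \<epsilon> by simp
  finally have e1: "ht / (2 * \<epsilon>) \<le> c * \<epsilon>" .
  let ?S = "\<alpha> * (L + 1) powr (\<alpha> - 1)"
  have e2: "B * (ht * (L powr \<alpha>)\<^sup>2) \<le> B * (c * \<epsilon> * (L powr \<alpha>)\<^sup>2)"
    using ht\<epsilon> B by (intro mult_left_mono mult_right_mono) auto
  have e3: "B * (?S * (hr / (2 * \<epsilon>))) \<le> B * (?S * \<epsilon>)"
    using B alpha \<epsilon> unfolding half by (intro mult_left_mono) auto
  have "H_lip \<le> ?S"
    unfolding H_lip_def using alpha L_nonneg by (intro mult_left_mono powr_mono2) auto
  then have e4: "B * (H_lip * (hr / (2 * \<epsilon>))) \<le> B * (?S * (hr / (2 * \<epsilon>)))"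
    using B hr \<epsilon> by (intro mult_left_mono mult_right_mono) auto
  have rate: "rate * \<epsilon> = c * \<epsilon> + B * (c * \<epsilon> * (L powr \<alpha>)\<^sup>2) + B * (?S * \<epsilon>)"
    unfolding rate_def c_def[symmetric] by (simp add: algebra_simps)
  have "0 \<le> B * (c * \<epsilon> * (L powr \<alpha>)\<^sup>2)" using B c \<epsilon> by simp
  then have err1: "ht / (2 * \<epsilon>) + B * (H_lip * (hr / (2 * \<epsilon>))) \<le> rate * \<epsilon>"
    and err2: "ht / (2 * \<epsilon>) + B * (ht * (L powr \<alpha>)\<^sup>2) + B * (?S * (hr / (2 * \<epsilon>))) \<le> rate * \<epsilon>"
    using e1 e2 e3 e4 rate by linarith+
  have "0 \<le> rate * \<epsilon>" using order_trans[OF _ err1] ht hr \<epsilon> B lip by simp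
  then have nrate: "real n * ht * (rate * \<epsilon>) \<le> T * (rate * \<epsilon>)" using nT by (intro mult_right_mono)
  have "0 \<le> K\<^sup>2 * \<epsilon>" "0 \<le> L\<^sup>2 * \<epsilon>" using \<epsilon> by auto
  then have E0: "K\<^sup>2 * \<epsilon> / 2 + L\<^sup>2 * \<epsilon> / 2 \<le> (K\<^sup>2 + L\<^sup>2) * \<epsilon>" by (simp add: distrib_right)
  have pt: "0 \<le> real n * ht" "0 \<le> real j * hr" using ht hr by auto
  have "hr \<le> 2 * \<epsilon>" using hr_le \<epsilon> by linarith
  \<comment> \<open>At the grid point itself both parabolas vanish.\<close>
  with scheme_lower_bound[OF \<epsilon>(1) E0 err1 pt, of n j] scheme_upper_bound[OF \<epsilon>(1) _ E0 err2 pt, of n j]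
  have "\<bar>m (real n * ht) (real j * hr) - M n j\<bar> \<le> (K\<^sup>2 + L\<^sup>2) * \<epsilon> + real n * ht * (rate * \<epsilon>)"
    by (simp add: abs_le_iff)
  also have "\<dots> \<le> (K\<^sup>2 + L\<^sup>2 + T * rate) * \<epsilon>" using nrate by (simp add: algebra_simps)
  finally show ?thesis by (simp add: \<epsilon>_def)
qed

end

section \<open>The zero datum and the conclusion\<close>

lemma schemeM_trivial:
  fixes ht hr :: real
  assumes "\<And>r. 0 \<le> r \<Longrightarrow> m0 r = 0" "0 < hr"
  shows "schemeM \<alpha> m0 ht hr n j = 0"
proof (induction n arbitrary: j)
  case (Suc n)
  then show ?case by (cases j) auto
qed (use assms in simp)

theorem mainTheorem13:
  fixes \<alpha> :: real and m0 :: "real \<Rightarrow> real" and m :: "real \<Rightarrow> real \<Rightarrow> real"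
  assumes "\<alpha> \<ge> 1"
    and "\<forall>r\<ge>0. m0 r \<ge> 0"
    and "bounded (m0 ` {0..})"
    and "\<exists>K. K-lipschitz_on {0..} m0"
    and "mono_on {0..} m0"
    and "m0 0 = 0"
    and "visc_solution \<alpha> m0 m"
  shows "\<forall>T>0. \<exists>C. \<forall>ht hr. ht > 0 \<longrightarrow> hr > 0 \<longrightarrow> CFL \<alpha> m0 ht hr \<longrightarrow>
           (\<forall>n j. real n * ht \<le> T \<longrightarrow>
              \<bar>m (real n * ht) (real j * hr) - schemeM \<alpha> m0 ht hr n j\<bar> \<le> C * hr powr (1/3))"
proof (intro allI impI)
  fix T :: real
  assume T: "0 < T"
  interpret mass_problem \<alpha> m0 m using assms by unfold_locales auto
  show "\<exists>C. \<forall>ht hr. ht > 0 \<longrightarrow> hr > 0 \<longrightarrow> CFL \<alpha> m0 ht hr \<longrightarrow>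
           (\<forall>n j. real n * ht \<le> T \<longrightarrow>
              \<bar>m (real n * ht) (real j * hr) - schemeM \<alpha> m0 ht hr n j\<bar> \<le> C * hr powr (1/3))"
  proof (cases "0 < L \<and> 0 < B")
    \<comment> \<open>Here \<open>CFL\<close> gives no bound on \<open>ht / hr\<close>, but the
      datum vanishes on the half-line, and so do solution and scheme.\<close>
    case False
    have m0: "m0 r = 0" if "0 \<le> r" for r
    proof -
      have "L = 0 \<or> B = 0" using False L_nonneg B_nonneg by linarith
      then have "m0 r \<le> 0" using m0_diff_le[of r 0] m0_le[of r] m0_zero that by auto
      then show ?thesis using m0_nonneg[OF that] by simp
    qed
    have "m t r = 0" if "0 \<le> t" "0 \<le> r" for t r
      using m_nonneg[OF that] m_le_m0[OF that] m0[OF that(2)] by simp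
    then show ?thesis using schemeM_trivial[OF m0] by (intro exI[of _ 0]) auto
  next
    case True
    \<comment> \<open>\<open>rate\<close> depends only on \<alpha> and \<open>m0\<close>, so
      \<open>C\<close> can be fixed before the mesh sizes.\<close>
    define C where "C = K\<^sup>2 + L\<^sup>2 + T * mass_scheme.rate \<alpha> m0"
    show ?thesis
    proof (intro exI[of _ "max B C"] allI impI)
      fix ht hr :: real and n j
      assume h: "0 < ht" "0 < hr" "CFL \<alpha> m0 ht hr" "real n * ht \<le> T"
      then interpret mass_scheme \<alpha> m0 m ht hr using True by unfold_locales auto
      show "\<bar>m (real n * ht) (real j * hr) - M n j\<bar> \<le> max B C * hr powr (1/3)"
      proof (cases "hr \<le> 1")
        case True
        have "\<bar>m (real n * ht) (real j * hr) - M n j\<bar> \<le> C * sqrt hr"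
          unfolding C_def using \<open>0 < L \<and> 0 < B\<close> True h by (intro scheme_error) auto
        also have "\<dots> \<le> max B C * sqrt hr" using hr by (intro mult_right_mono) auto
        \<comment> \<open>On \<open>hr \<le> 1\<close> the smaller exponent gives the larger
          power.\<close>
        also have "sqrt hr \<le> hr powr (1/3)"
          using powr_mono'[of "1/3" "1/2" hr] hr True by (simp add: powr_half_sqrt)
        finally show ?thesis using B_nonneg by (simp add: mult_left_mono)
      next
        \<comment> \<open>Both values lie in \<open>[0, B]\<close>, while
          \<open>hr powr (1/3)\<close> is at least 1.\<close>
        case False
        have "\<bar>m (real n * ht) (real j * hr) - M n j\<bar> \<le> B"
          using m_nonneg[of "real n * ht" "real j * hr"] m_le_B[of "real n * ht" "real j * hr"]
            M_nonneg[of n j] M_le_B[of n j] ht hr by (simp add: abs_le_iff)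
        also have "\<dots> \<le> max B C * 1" by simp
        also have "\<dots> \<le> max B C * hr powr (1/3)"
          using False B_nonneg by (intro mult_left_mono ge_one_powr_ge_zero) auto
        finally show ?thesis .
      qed
    qed
  qed
qed

end
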